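(* Let $n_1\ge 1$ and $i_1,i_2,i_3\in\mathbb{Z}$, and let $V$ be the toric variety $\mathbb{C}P(\eta^{\otimes i_1}\oplus\eta^{\otimes i_2}\oplus\eta^{\otimes i_3}\oplus\underline{\mathbb{C}})$ over $\mathbb{C}P^{n_1}$, where $\eta$ is the tautological line bundle over $\mathbb{C}P^{n_1}$ and $\underline{\mathbb{C}}$ is the trivial line bundle. Let $\alpha_1,\dots,\alpha_{n_1+5}\in\mathbb{C}\setminus\mathbb{Z}$ be the values of the degree function $\deg$ on the primitive generators of the one-dimensional cones of the fan of $V$ (indexed as described in the context). Assume that each of the triples $$(i_1,i_2,i_3),\quad (i_1,\,i_1-i_2,\,i_1-i_3),\quad (i_2,\,i_2-i_1,\,i_2-i_3),\quad (i_3,\,i_3-i_1,\,i_3-i_2)$$ consists of pairwise coprime integers, that $\sum_{j=0}^{3}\alpha_{n_1+2+j}\in\mathbb{Z}$, and that $\sum_{i=1}^{n_1+1}\alpha_i-\sum_{j=1}^{3}i_j\,\alpha_{n_1+2+j}\in\mathbb{Z}$. Then the toric form of $V$ vanishes: $f_{N,\deg}(q)=0$.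
   Context: Toric form (Borisov–Gunnells). Let $N$ be a lattice of rank $r$, $M$ its dual lattice, and $\Sigma$ a complete rational polyhedral fan in $N\otimes\mathbb{R}$. A degree function $\deg:N\to\mathbb{C}$ is a function that is linear on each cone of $\Sigma$; it is determined by its values on the primitive generators of the one-dimensional cones when $\Sigma$ is smooth. With $q=e^{2\pi\sqrt{-1}\,\tau}$, $\tau\in\mathbb{H}$, and for each cone $C\in\Sigma$, the sum $\sum_{n\in C\cap N}q^{m\cdot n}e^{2\pi\sqrt{-1}\,\deg(n)}$ converges for $m\in M\otimes\mathbb{C}$ with $m\cdot(C\setminus\{0\})>0$ and $\mathrm{Im}\,\tau$ large, and is extended to other $m$ by analytic continuation (a.c.); for a smooth cone $C$ with primitive generators $d_1,\dots,d_s$ the continuation is $\prod_{l=1}^s(1-e^{2\pi\sqrt{-1}\,\deg(d_l)}q^{m\cdot d_l})^{-1}$. The toric form is $$f_{N,\deg}(q)=\sum_{m\in M}\Big(\sum_{C\in\Sigma}(-1)^{\operatorname{codim}C}\ \mathrm{a.c.}\Big(\sum_{n\in C\cap N}q^{m\cdot n}e^{2\pi\sqrt{-1}\,\deg(n)}\Big)\Big),$$ the sum over $M$ converging absolutely and uniformly for $|q|<\epsilon$ for some $\epsilon>0$. Fan of $V$ and indexing. Here $N=\mathbb{Z}^{n_1+3}$ with basis $e_1,\dots,e_{n_1},g_1,g_2,g_3$. The primitive generators of the rays of the fan $\Sigma$ of $V$ and the values of $\deg$ on them are: $e_s\mapsto\alpha_s$ for $1\le s\le n_1$; $-e_1-\cdots-e_{n_1}+i_1g_1+i_2g_2+i_3g_3\mapsto\alpha_{n_1+1}$;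 $-g_1-g_2-g_3\mapsto\alpha_{n_1+2}$; $g_j\mapsto\alpha_{n_1+2+j}$ for $j=1,2,3$. A set of generators spans a cone of $\Sigma$ iff it contains neither all of the first $n_1+1$ generators nor all of the last four. Equivalently, with $u=-c_1(\eta)$ and $v=-c_1(\gamma)$, $\gamma$ the tautological line bundle over $V$, the toric divisors with labels $\alpha_1,\dots,\alpha_{n_1+1}$ have class $u$, the one with label $\alpha_{n_1+2}$ has class $v$, and the one with label $\alpha_{n_1+2+j}$ has class $v-i_ju$. *)

theory Defs
  imports "HOL-Analysis.Analysis"
begin

text \<open>
  The lattice \<open>N\<close> of rank \<open>r = CARD('r)\<close> and its dual \<open>M\<close> are both modelled as
  \<^typ>\<open>int ^ 'r\<close> with the standard pairing; \<open>N\<close> tensored with the reals is \<^typ>\<open>real ^ 'r\<close>,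
  and \<open>M\<close> tensored with the complex numbers is \<^typ>\<open>complex ^ 'r\<close>. A fan is the set of its cones.
\<close>

definition real_vec :: "int ^ 'r \<Rightarrow> real ^ 'r" where
  "real_vec n = (\<chi> k. real_of_int (n $ k))"

definition complex_vec :: "int ^ 'r \<Rightarrow> complex ^ 'r" where
  "complex_vec m = (\<chi> k. of_int (m $ k))"

definition pairing :: "complex ^ 'r \<Rightarrow> int ^ 'r \<Rightarrow> complex" where
  "pairing m n = (\<Sum>k\<in>UNIV. m $ k * of_int (n $ k))"

definition lattice_points :: "(real ^ 'r) set \<Rightarrow> (int ^ 'r) set" where
  "lattice_points C = {n. real_vec n \<in> C}"

definition cone_spanned :: "('k \<Rightarrow> int ^ 'r) \<Rightarrow> 'k set \<Rightarrow> (real ^ 'r) set" where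
  "cone_spanned d S = {(\<Sum>k\<in>S. t k *\<^sub>R real_vec (d k)) | t. \<forall>k\<in>S. 0 \<le> t k}"

definition degree_function :: "(real ^ 'r) set set \<Rightarrow> (int ^ 'r \<Rightarrow> complex) \<Rightarrow> bool" where
  "degree_function \<Sigma> deg \<longleftrightarrow>
     (\<forall>C\<in>\<Sigma>. \<exists>l :: real ^ 'r \<Rightarrow> complex. linear l \<and>
        (\<forall>n\<in>lattice_points C. deg n = l (real_vec n)))"


subsection \<open>Analytic continuation of the lattice point series of a cone\<close>

text \<open>With \<open>q = exp (2 \<pi> \<i> \<tau>)\<close>, the power of \<open>q\<close> with complex exponent \<open>z\<close> is \<open>exp (2 \<pi> \<i> \<tau> z)\<close>.\<close>

definition cone_series_term ::
  "(int ^ 'r \<Rightarrow> complex) \<Rightarrow> complex \<Rightarrow> complex ^ 'r \<Rightarrow> int ^ 'r \<Rightarrow> complex" where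
  "cone_series_term deg \<tau> m n =
     exp (2 * of_real pi * \<i> * \<tau> * pairing m n) * exp (2 * of_real pi * \<i> * deg n)"

definition entire :: "(complex ^ 'r \<Rightarrow> complex) \<Rightarrow> bool" where
  "entire F \<longleftrightarrow>
     (\<forall>x. \<exists>F'. (F has_derivative F') (at x) \<and> (\<forall>c y. F' (c *s y) = c * F' y))"

text \<open>
  For fixed \<open>\<tau>\<close> the series over the lattice points of \<open>C\<close> is continued in \<open>m\<close>, as a global
  meromorphic function written as a quotient of entire functions, from the region where it converges
  absolutely (for complex series, \<open>summable_on\<close> is absolute convergence). For a strictly convex
  cone that region contains all sufficiently large positive multiples of every real \<open>m\<close> that is
  positive on \<open>C - {0}\<close>, so fixing \<open>\<tau>\<close> and moving \<open>m\<close> replaces the condition that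
  \<open>Im \<tau>\<close> be large. The relation says that the continuation is regular at \<open>m\<close> with value \<open>v\<close>.
\<close>

definition cone_series_continues ::
  "(int ^ 'r \<Rightarrow> complex) \<Rightarrow> complex \<Rightarrow> (real ^ 'r) set \<Rightarrow> complex ^ 'r \<Rightarrow> complex \<Rightarrow> bool" where
  "cone_series_continues deg \<tau> C m v \<longleftrightarrow>
     (\<exists>P Q. entire P \<and> entire Q \<and>
        (\<forall>w. cone_series_term deg \<tau> w summable_on lattice_points C \<longrightarrow>
             Q w * infsum (cone_series_term deg \<tau> w) (lattice_points C) = P w) \<and>
        Q m \<noteq> 0 \<and> v = P m / Q m)"

definition cone_ac ::
  "(int ^ 'r \<Rightarrow> complex) \<Rightarrow> complex \<Rightarrow> (real ^ 'r) set \<Rightarrow> complex ^ 'r \<Rightarrow> complex" where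
  "cone_ac deg \<tau> C m = (THE v. cone_series_continues deg \<tau> C m v)"


subsection \<open>Toric forms\<close>

definition toric_summand ::
  "(real ^ 'r) set set \<Rightarrow> (int ^ 'r \<Rightarrow> complex) \<Rightarrow> complex \<Rightarrow> int ^ 'r \<Rightarrow> complex" where
  "toric_summand \<Sigma> deg \<tau> m =
     (\<Sum>C\<in>\<Sigma>. (-1) ^ (CARD('r) - dim C) * cone_ac deg \<tau> C (complex_vec m))"

definition toric_form ::
  "(real ^ 'r) set set \<Rightarrow> (int ^ 'r \<Rightarrow> complex) \<Rightarrow> complex \<Rightarrow> complex" where
  "toric_form \<Sigma> deg \<tau> = (\<Sum>\<^sub>\<infinity>m\<in>UNIV. toric_summand \<Sigma> deg \<tau> m)"


subsection \<open>The fan of the projective bundle\<close>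

text \<open>
  The coordinates are enumerated by a bijection \<open>b\<close> from \<open>{1..n1 + 3}\<close> onto the index type \<open>'r\<close>:
  the basis vector \<open>e\<^sub>s\<close> sits at coordinate \<open>b s\<close> for \<open>1 \<le> s \<le> n1\<close>, and \<open>g\<^sub>j\<close> at coordinate
  \<open>b (n1 + j)\<close> for \<open>j = 1, 2, 3\<close>. Rays are numbered \<open>1, \<dots>, n1 + 5\<close>, like the values
  of the degree function; the last three rays \<open>n1 + 2 + j\<close> are the \<open>g\<^sub>j\<close>.
\<close>

definition ray :: "nat \<Rightarrow> (nat \<Rightarrow> int) \<Rightarrow> (nat \<Rightarrow> 'r) \<Rightarrow> nat \<Rightarrow> int ^ 'r" where
  "ray n1 i b k =
     (let e = (\<lambda>s. axis (b s) 1); g = (\<lambda>j. axis (b (n1 + j)) 1) in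
      if k \<le> n1 then e k
      else if k = n1 + 1 then - (\<Sum>s = 1..n1. e s) + (\<Sum>j = 1..3. i j *s g j)
      else if k = n1 + 2 then - (\<Sum>j = 1..3. g j)
      else g (k - (n1 + 2)))"

definition bundle_fan :: "nat \<Rightarrow> (nat \<Rightarrow> int) \<Rightarrow> (nat \<Rightarrow> 'r) \<Rightarrow> (real ^ 'r) set set" where
  "bundle_fan n1 i b =
     {cone_spanned (ray n1 i b) S | S.
        S \<subseteq> {1..n1 + 5} \<and> \<not> {1..n1 + 1} \<subseteq> S \<and> \<not> {n1 + 2..n1 + 5} \<subseteq> S}"

definition pairwise_coprime3 :: "int \<Rightarrow> int \<Rightarrow> int \<Rightarrow> bool" where
  "pairwise_coprime3 x y z \<longleftrightarrow> coprime x y \<and> coprime x z \<and> coprime y z"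

end

theory Submission
  imports Defs "HOL-Complex_Analysis.Conformal_Mappings"
begin

text \<open>
  Every cone of the fan is unimodular, so its continued series at \<open>m\<close> is the product of
  \<open>1 / (1 - x\<^sub>k)\<close> over its rays, where \<open>x\<^sub>k\<close> is the series term at the \<open>k\<close>-th ray; none of
  the \<open>x\<^sub>k\<close> equals \<open>1\<close> once \<open>Im \<tau>\<close> exceeds all \<open>\<bar>Im \<alpha>\<^sub>k\<bar>\<close>. The faces of the fan are unions of
  a proper subset of the base rays and a proper subset of the four fibre rays, hence the alternating
  sum over the cones factors accordingly. The fibre factor is a multiple of
  \<open>1 - \<Prod>x\<^sub>k\<close> over the fibre rays. These rays sum to \<open>0\<close> and their degrees sum to an integer,
  so the product is \<open>1\<close>, and the toric summand vanishes at every single \<open>m\<close>.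
\<close>

section \<open>Lattice pairing and multiplicativity of the series terms\<close>

lemma real_vec_sum: "real_vec (\<Sum>k\<in>S. f k) = (\<Sum>k\<in>S. real_vec (f k))"
  by (simp add: real_vec_def vec_eq_iff)

lemma real_vec_scale: "real_vec (c *s n) = of_int c *\<^sub>R real_vec n"
  by (simp add: real_vec_def vec_eq_iff)

lemma pairing_scale: "pairing (c *s w) n = c * pairing w n"
  by (simp add: pairing_def sum_distrib_left mult_ac)

lemma pairing_add: "pairing (v + w) n = pairing v n + pairing w n"
  by (simp add: pairing_def sum.distrib distrib_right)

lemma pairing_sum_right:
  "pairing w (\<Sum>k\<in>S. of_nat (a k) *s d k) = (\<Sum>k\<in>S. of_nat (a k) * pairing w (d k))"
proof -
  have "pairing w (\<Sum>k\<in>S. of_nat (a k) *s d k) 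
      = (\<Sum>j\<in>UNIV. \<Sum>k\<in>S. of_nat (a k) * (w $ j * of_int (d k $ j)))"
    by (simp add: pairing_def sum_distrib_left mult_ac)
  also have "\<dots> = (\<Sum>k\<in>S. of_nat (a k) * pairing w (d k))"
    by (subst sum.swap) (simp add: pairing_def sum_distrib_left)
  finally show ?thesis .
qed

text \<open>Pairing and degree are both additive along the combination, and the exponential turns
  sums into products. Linearity is asked only at the points that occur, because \<open>deg\<close>
  is linear on each cone separately.\<close>

lemma cone_series_term_sum:
  assumes l: "linear l" and deg: "\<And>n. n \<in> insert (\<Sum>k\<in>S. of_nat (a k) *s d k) (d ` S) \<Longrightarrow> deg n = l (real_vec n)"
  shows "cone_series_term deg \<tau> w (\<Sum>k\<in>S. of_nat (a k) *s d k)
       = (\<Prod>k\<in>S. cone_series_term deg \<tau> w (d k) ^ a k)"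
proof (cases "finite S")
  case True
  have "deg (\<Sum>k\<in>S. of_nat (a k) *s d k) = (\<Sum>k\<in>S. of_nat (a k) * deg (d k))"
    using deg by (simp add: real_vec_sum real_vec_scale linear_sum[OF l] linear_cmul[OF l]) (simp add: scaleR_conv_of_real)
  then show ?thesis using True
    by (simp add: cone_series_term_def pairing_sum_right power_mult_distrib prod.distrib 
       exp_sum sum_distrib_left exp_of_nat_mult[symmetric] mult_ac)
next
  case False
  \<comment> \<open>For infinite \<open>S\<close> the sum is \<open>0\<close> and the product
    \<open>1\<close> by convention, so only the degree of \<open>0\<close> matters.\<close>
  have "deg 0 = 0" using deg[of 0] False linear_0[OF l] by (simp add: real_vec_def zero_vec_def[symmetric])
  with False show ?thesis by (simp add: cone_series_term_def pairing_def)
qed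

subsection \<open>Entire functions\<close>

lemma entire_const: "entire (\<lambda>_. c)"
  unfolding entire_def by (auto intro!: exI[of _ "\<lambda>_. 0"])

lemma entire_diff:
  assumes "entire F" "entire G" shows "entire (\<lambda>x. F x - G x)"
  unfolding entire_def
proof
  fix x
  obtain F' G' where "(F has_derivative F') (at x)" "\<forall>c y. F' (c *s y) = c * F' y"
     "(G has_derivative G') (at x)" "\<forall>c y. G' (c *s y) = c * G' y"
    using assms unfolding entire_def by metis
  then show "\<exists>F'. ((\<lambda>x. F x - G x) has_derivative F') (at x) \<and> (\<forall>c y. F' (c *s y) = c * F' y)"
    by (intro exI[of _ "\<lambda>h. F' h - G' h"]) (auto intro!: derivative_intros simp: algebra_simps)
qed

lemma entire_mult:
  assumes "entire F" "entire G" shows "entire (\<lambda>x. F x * G x)"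
  unfolding entire_def
proof
  fix x
  obtain F' G' where "(F has_derivative F') (at x)" "\<forall>c y. F' (c *s y) = c * F' y"
     "(G has_derivative G') (at x)" "\<forall>c y. G' (c *s y) = c * G' y"
    using assms unfolding entire_def by metis
  then show "\<exists>F'. ((\<lambda>x. F x * G x) has_derivative F') (at x) \<and> (\<forall>c y. F' (c *s y) = c * F' y)"
    by (intro exI[of _ "\<lambda>h. F x * G' h + F' h * G x"]) (auto intro!: derivative_intros simp: algebra_simps)
qed

lemma entire_prod:
  assumes "\<And>k. k \<in> S \<Longrightarrow> entire (F k)" shows "entire (\<lambda>x. \<Prod>k\<in>S. F k x)"
  using assms by (induction S rule: infinite_finite_induct) (simp_all add: entire_const entire_mult)

lemma entire_cone_series_term: "entire (\<lambda>w. cone_series_term deg \<tau> w n)"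
  unfolding entire_def
proof
  fix x
  define L where "L = (\<lambda>w. 2 * of_real pi * \<i> * \<tau> * pairing w n)"
  have "linear L"
    by (rule linearI) (auto simp: L_def pairing_add distrib_left, simp add: pairing_def scaleR_sum_right sum_distrib_left)
  then have "(L has_derivative L) (at x)"
    by (simp add: linear_conv_bounded_linear bounded_linear_imp_has_derivative)
  from has_derivative_compose[OF this DERIV_exp[unfolded has_field_derivative_def]]
  have "((\<lambda>w. exp (L w) * exp (2 * of_real pi * \<i> * deg n)) has_derivative
      (\<lambda>h. exp (L x) * L h * exp (2 * of_real pi * \<i> * deg n))) (at x)"
    by (rule has_derivative_mult_left)
  moreover have "L (c *s y) = c * L y" for c y by (simp add: L_def pairing_scale)
  ultimately show "\<exists>F'. ((\<lambda>w. cone_series_term deg \<tau> w n) has_derivative F') (at x) \<and> (\<forall>c y. F' (c *s y) = c * F' y)"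
    unfolding cone_series_term_def L_def
    by (intro exI conjI allI) (assumption, simp)
qed

text \<open>Restriction to a complex line makes the one-variable identity theorem available for
  functions of several variables. Homogeneity of \<open>F'\<close> over the complex numbers turns
  the real derivative into a complex one.\<close>

lemma entire_holomorphic_line:
  assumes "entire F" shows "(\<lambda>t. F (m + t *s w)) holomorphic_on UNIV"
  unfolding holomorphic_on_def field_differentiable_def
proof
  fix t :: complex
  obtain F' where F': "(F has_derivative F') (at (m + t *s w))" "\<And>c y. F' (c *s y) = c * F' y"
    using assms unfolding entire_def by blast
  have "linear (\<lambda>t. t *s w)"
    by (rule linearI) (auto simp: vec_eq_iff algebra_simps)
  then have "((\<lambda>t. t *s w) has_derivative (\<lambda>t. t *s w)) (at t)"
    by (simp add: linear_conv_bounded_linear bounded_linear_imp_has_derivative)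
  then have "((\<lambda>t. m + t *s w) has_derivative (\<lambda>t. t *s w)) (at t)"
    by (auto intro!: derivative_eq_intros)
  from has_derivative_compose[OF this F'(1)]
  show "\<exists>f'. ((\<lambda>t. F (m + t *s w)) has_field_derivative f') (at t within UNIV)"
    by (intro exI[of _ "F' w"]) (simp add: has_field_derivative_def F'(2) mult_commute_abs)
qed

subsection \<open>Unimodular cones\<close>

text \<open>Unimodularity is encoded by what the lattice point series uses: real independence of the
  generators and natural coefficients for every lattice point of the cone.\<close>

locale unimodular_cone =
  fixes d :: "'k \<Rightarrow> int ^ 'r" and S :: "'k set"
  assumes finite: "finite S"
    and relation_free: "\<And>c k. (\<Sum>k\<in>S. c k *\<^sub>R real_vec (d k)) = 0 \<Longrightarrow> k \<in> S \<Longrightarrow> c k = 0"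
    and lattice_pointE: "\<And>n. n \<in> lattice_points (cone_spanned d S) \<Longrightarrow>
      \<exists>a. n = (\<Sum>k\<in>S. of_nat (a k) *s d k)"
begin

lemma coeffs_unique:
  assumes "(\<Sum>k\<in>S. c k *\<^sub>R real_vec (d k)) = (\<Sum>k\<in>S. c' k *\<^sub>R real_vec (d k))" "k \<in> S"
  shows "c k = c' k"
proof -
  have "(\<Sum>k\<in>S. (c k - c' k) *\<^sub>R real_vec (d k)) = 0"
    using assms(1) by (simp add: sum_subtractf scaleR_diff_left)
  from relation_free[OF this assms(2)] show ?thesis by simp
qed

lemma inj_on_generators: "inj_on (\<lambda>k. real_vec (d k)) S"
proof
  fix j k assume jk: "j \<in> S" "k \<in> S" "real_vec (d j) = real_vec (d k)"
  have "(\<Sum>l\<in>S. (if l = j then 1 else 0) *\<^sub>R real_vec (d l)) = (\<Sum>l\<in>S. (if l = k then 1 else 0) *\<^sub>R real_vec (d l))"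
    using jk finite by (simp add: if_distrib[of "\<lambda>c. c *\<^sub>R _"] sum.delta cong: if_cong)
  from coeffs_unique[OF this jk(1)] show "j = k" by (auto split: if_splits)
qed

lemma independent_generators: "independent ((\<lambda>k. real_vec (d k)) ` S)"
  unfolding independent_explicit
proof (intro conjI allI impI ballI)
  fix c v
  assume "(\<Sum>v\<in>(\<lambda>k. real_vec (d k)) ` S. c v *\<^sub>R v) = 0"
    and v: "v \<in> (\<lambda>k. real_vec (d k)) ` S"
  then have "(\<Sum>k\<in>S. c (real_vec (d k)) *\<^sub>R real_vec (d k)) = 0"
    by (simp add: sum.reindex[OF inj_on_generators])
  from relation_free[OF this] v show "c v = 0" by blast
qed (simp add: finite)

lemma lattice_points_eq:
  "lattice_points (cone_spanned d S) = range (\<lambda>a. \<Sum>k\<in>S. of_nat (a k) *s d k)"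
proof
  show "lattice_points (cone_spanned d S) \<subseteq> range (\<lambda>a. \<Sum>k\<in>S. of_nat (a k) *s d k)"
    using lattice_pointE by blast
  show "range (\<lambda>a. \<Sum>k\<in>S. of_nat (a k) *s d k) \<subseteq> lattice_points (cone_spanned d S)"
    by (force simp: lattice_points_def cone_spanned_def real_vec_sum real_vec_scale)
qed

lemma nat_coeffs_unique:
  assumes "(\<Sum>k\<in>S. of_nat (a k) *s d k) = (\<Sum>k\<in>S. of_nat (a' k) *s d k)" "k \<in> S"
  shows "a k = a' k"
proof -
  have "(\<Sum>k\<in>S. real (a k) *\<^sub>R real_vec (d k)) = (\<Sum>k\<in>S. real (a' k) *\<^sub>R real_vec (d k))"
    using arg_cong[OF assms(1), of real_vec] unfolding real_vec_sum real_vec_scale by simp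
  from coeffs_unique[OF this assms(2)] show ?thesis by simp
qed

lemma generator_mem: "k \<in> S \<Longrightarrow> real_vec (d k) \<in> cone_spanned d S"
proof -
  assume "k \<in> S"
  then have "real_vec (d k) = (\<Sum>j\<in>S. (if j = k then 1 else 0) *\<^sub>R real_vec (d j))"
    using finite by (simp add: if_distrib[of "\<lambda>c. c *\<^sub>R _"] sum.delta cong: if_cong)
  then show ?thesis
    unfolding cone_spanned_def by (intro CollectI exI[of _ "\<lambda>j. if j = k then 1 else 0"]) simp
qed

text \<open>This turns the codimension sign of a cone into a sign depending only on the number of
  its rays.\<close>

lemma dim_cone: "dim (cone_spanned d S) = card S"
proof (rule dim_unique[of "(\<lambda>k. real_vec (d k)) ` S"])
  show "(\<lambda>k. real_vec (d k)) ` S \<subseteq> cone_spanned d S"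
    using generator_mem by blast
  show "cone_spanned d S \<subseteq> span ((\<lambda>k. real_vec (d k)) ` S)"
    by (auto simp: cone_spanned_def intro!: span_sum span_scale intro: span_base)
qed (use independent_generators card_image[OF inj_on_generators] in auto)

text \<open>\<open>PiE\<close> fixes the exponents outside \<open>S\<close>, which makes the
  parametrisation injective and brings the series into the shape of an infinite sum of
  products.\<close>

lemma bij_betw_lattice_points:
  "bij_betw (\<lambda>a. \<Sum>k\<in>S. of_nat (a k) *s d k) (PiE S (\<lambda>_. UNIV)) (lattice_points (cone_spanned d S))"
  unfolding bij_betw_def
proof
  show "inj_on (\<lambda>a. \<Sum>k\<in>S. of_nat (a k) *s d k) (PiE S (\<lambda>_. UNIV))"
    by (rule inj_onI, rule PiE_ext) (auto intro: nat_coeffs_unique)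
  have "(\<Sum>k\<in>S. of_nat (a k) *s d k) \<in> (\<lambda>a. \<Sum>k\<in>S. of_nat (a k) *s d k) ` (PiE S (\<lambda>_. UNIV))" for a
    by (rule image_eqI[of _ _ "restrict a S"]) auto
  then show "(\<lambda>a. \<Sum>k\<in>S. of_nat (a k) *s d k) ` (PiE S (\<lambda>_. UNIV)) = lattice_points (cone_spanned d S)"
    unfolding lattice_points_eq by blast
qed

text \<open>Independent generators admit a real functional with value \<open>1\<close> on each; its
  values on the standard basis are the coordinates of the witness. It yields a direction in which
  all generator terms decay at the same rate.\<close>

lemma exists_dual_vector: "\<exists>v. \<forall>k\<in>S. pairing v (d k) = 1"
proof -
  obtain f :: "real ^ 'r \<Rightarrow> real" where f: "linear f" "\<And>k. k \<in> S \<Longrightarrow> f (real_vec (d k)) = 1"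
    using linear_independent_extend[OF independent_generators, of "\<lambda>_. 1"] by auto
  have "pairing (\<chi> j. of_real (f (axis j 1))) n = of_real (f (real_vec n))" for n
  proof -
    have "f (real_vec n) = f (\<Sum>j\<in>UNIV. (real_vec n $ j) *\<^sub>R axis j 1)"
      using basis_expansion[of "real_vec n"] by (simp add: scalar_mult_eq_scaleR)
    also have "\<dots> = (\<Sum>j\<in>UNIV. real_of_int (n $ j) * f (axis j 1))"
      by (simp add: linear_sum[OF f(1)] linear_cmul[OF f(1)] real_vec_def)
    finally show ?thesis by (simp add: pairing_def mult.commute)
  qed
  with f(2) show ?thesis by (metis of_real_1)
qed

section \<open>The series of one cone and its continuation\<close>

context
  fixes deg :: "int ^ 'r \<Rightarrow> complex" and \<tau> :: complex and l :: "real ^ 'r \<Rightarrow> complex"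
  assumes l: "linear l" "\<And>n. n \<in> lattice_points (cone_spanned d S) \<Longrightarrow> deg n = l (real_vec n)"
begin

lemma term_lattice_point:
  "cone_series_term deg \<tau> w (\<Sum>k\<in>S. of_nat (a k) *s d k)
       = (\<Prod>k\<in>S. cone_series_term deg \<tau> w (d k) ^ a k)"
proof (rule cone_series_term_sum[OF l(1)], rule l(2))
  show "n \<in> lattice_points (cone_spanned d S)"
    if "n \<in> insert (\<Sum>k\<in>S. of_nat (a k) *s d k) (d ` S)" for n
  proof (cases "n \<in> d ` S")
    case True
    then show ?thesis using generator_mem by (auto simp: lattice_points_def)
  next
    case False
    then show ?thesis using that unfolding lattice_points_eq by blast
  qed
qed

text \<open>Summing over exponent vectors gives a product of geometric series; absolute convergence
  of each factor justifies the interchange.\<close>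

lemma cone_series_geometric:
  assumes "\<And>k. k \<in> S \<Longrightarrow> norm (cone_series_term deg \<tau> w (d k)) < 1"
  shows "cone_series_term deg \<tau> w summable_on lattice_points (cone_spanned d S)"
    and "infsum (cone_series_term deg \<tau> w) (lattice_points (cone_spanned d S))
       = (\<Prod>k\<in>S. 1 / (1 - cone_series_term deg \<tau> w (d k)))"
proof -
  let ?x = "\<lambda>k. cone_series_term deg \<tau> w (d k)"
  have abs: "(\<lambda>n. norm (?x k ^ n)) summable_on UNIV" if "k \<in> S" for k
    using assms[OF that] 
    by (intro norm_summable_imp_summable_on) (simp add: norm_power summable_geometric)
  have "Infinite_Set_Sum.abs_summable_on (\<lambda>a. \<Prod>k\<in>S. ?x k ^ a k) (PiE S (\<lambda>_. UNIV))"
    using abs finite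
    by (intro abs_summable_on_prod_PiE) (auto simp flip: abs_summable_equivalent)
  then have "(\<lambda>a. \<Prod>k\<in>S. ?x k ^ a k) summable_on PiE S (\<lambda>_. UNIV)"
    using abs_summable_equivalent abs_summable_summable by blast
  then show "cone_series_term deg \<tau> w summable_on lattice_points (cone_spanned d S)"
    by (subst summable_on_reindex_bij_betw[OF bij_betw_lattice_points, symmetric]) (simp add: term_lattice_point)
  have "infsum (cone_series_term deg \<tau> w) (lattice_points (cone_spanned d S))
      = infsum (\<lambda>a. \<Prod>k\<in>S. ?x k ^ a k) (PiE S (\<lambda>_. UNIV))"
    by (subst infsum_reindex_bij_betw[OF bij_betw_lattice_points, symmetric]) (simp add: term_lattice_point)
  also have "\<dots> = (\<Prod>k\<in>S. infsum (\<lambda>n. ?x k ^ n) UNIV)"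
    using abs finite by (intro infsum_prod_PiE_abs) auto
  also have "\<dots> = (\<Prod>k\<in>S. 1 / (1 - ?x k))"
  proof (rule prod.cong)
    fix k assume k: "k \<in> S"
    have "((\<lambda>n. ?x k ^ n) has_sum 1 / (1 - ?x k)) UNIV"
      using abs[OF k] geometric_sums[OF assms[OF k]]
      by (intro norm_summable_imp_has_sum) (simp_all add: summable_on_imp_summable)
    then show "infsum (\<lambda>n. ?x k ^ n) UNIV = 1 / (1 - ?x k)" by (rule infsumI)
  qed simp
  finally show "infsum (cone_series_term deg \<tau> w) (lattice_points (cone_spanned d S))
       = (\<Prod>k\<in>S. 1 / (1 - ?x k))" .
qed

text \<open>On the multiples of a single generator the series is geometric, so convergence bounds
  its ratio. The region of convergence is thus known exactly, as required by the quantifier over all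
  \<open>w\<close> in \<open>cone_series_continues\<close>.\<close>

lemma norm_term_less_one:
  assumes "cone_series_term deg \<tau> w summable_on lattice_points (cone_spanned d S)" "k \<in> S"
  shows "norm (cone_series_term deg \<tau> w (d k)) < 1"
proof -
  define e where "e = (\<lambda>n j. if j = k then n else 0 :: nat)"
  define g where "g = (\<lambda>n. \<Sum>j\<in>S. of_nat (e n j) *s d j)"
  have "inj g"
  proof (rule injI)
    fix n n' assume "g n = g n'"
    then have "e n k = e n' k" unfolding g_def by (rule nat_coeffs_unique) fact
    then show "n = n'" by (simp add: e_def)
  qed
  moreover have "cone_series_term deg \<tau> w summable_on range g"
    by (rule summable_on_subset_banach[OF assms(1)]) (auto simp: lattice_points_eq g_def)
  ultimately have "(\<lambda>n. cone_series_term deg \<tau> w (g n)) summable_on UNIV"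
    by (simp add: summable_on_reindex o_def)
  moreover have "cone_series_term deg \<tau> w (g n) = cone_series_term deg \<tau> w (d k) ^ n" for n
    using assms(2) finite
    by (simp add: g_def term_lattice_point e_def if_distrib[of "\<lambda>n. _ ^ n"] prod.delta cong: if_cong)
  ultimately show ?thesis
    by (simp add: summable_on_imp_summable flip: summable_geometric_iff)
qed

text \<open>The quotient \<open>1 / Q0\<close> is one continuation. For any other quotient of
  \<open>P\<close> by \<open>Q\<close>, the identity \<open>P * Q0 = Q\<close> holds in the region
  of convergence and propagates to \<open>m\<close> along a complex line.\<close>

lemma cone_ac_eq:
  assumes "\<tau> \<noteq> 0" and "\<And>k. k \<in> S \<Longrightarrow> cone_series_term deg \<tau> m (d k) \<noteq> 1"
  shows "cone_ac deg \<tau> (cone_spanned d S) m = (\<Prod>k\<in>S. 1 / (1 - cone_series_term deg \<tau> m (d k)))"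
  unfolding cone_ac_def
proof (rule the_equality)
  let ?x = "\<lambda>w k. cone_series_term deg \<tau> w (d k)"
  define Q0 where "Q0 = (\<lambda>w. \<Prod>k\<in>S. 1 - ?x w k)"
  have Q0: "entire Q0"
    unfolding Q0_def by (intro entire_prod entire_diff entire_const entire_cone_series_term)
  have Q0m: "Q0 m \<noteq> 0" using assms(2) finite by (simp add: Q0_def)
  have sum: "Q0 w * infsum (cone_series_term deg \<tau> w) (lattice_points (cone_spanned d S)) = 1"
    if "\<And>k. k \<in> S \<Longrightarrow> norm (?x w k) < 1" for w
  proof -
    have "?x w k \<noteq> 1" if "k \<in> S" for k using \<open>\<And>k. k \<in> S \<Longrightarrow> norm (?x w k) < 1\<close>[OF that] by auto
    then show ?thesis
      by (simp add: cone_series_geometric[OF that] Q0_def flip: prod.distrib)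
  qed
  have val: "(\<Prod>k\<in>S. 1 / (1 - ?x m k)) = 1 / Q0 m"
    by (simp add: Q0_def prod_dividef)
  show "cone_series_continues deg \<tau> (cone_spanned d S) m (\<Prod>k\<in>S. 1 / (1 - ?x m k))"
    unfolding cone_series_continues_def
  \<comment> \<open>The equation shown first instantiates the numerator to the constant
    \<open>1\<close> and the denominator to \<open>Q0\<close>.\<close>
  proof (intro exI conjI allI impI)
    fix w assume "cone_series_term deg \<tau> w summable_on lattice_points (cone_spanned d S)"
    then show "Q0 w * infsum (cone_series_term deg \<tau> w) (lattice_points (cone_spanned d S)) = 1"
      using norm_term_less_one by (intro sum)
  qed (fact entire_const Q0 Q0m val)+
  fix v assume "cone_series_continues deg \<tau> (cone_spanned d S) m v"
  then obtain P Q where PQ: "entire P" "entire Q" "Q m \<noteq> 0" "v = P m / Q m"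
    and PQsum: "\<And>w. cone_series_term deg \<tau> w summable_on lattice_points (cone_spanned d S) \<Longrightarrow>
             Q w * infsum (cone_series_term deg \<tau> w) (lattice_points (cone_spanned d S)) = P w"
    unfolding cone_series_continues_def by blast
  obtain v0 where v0: "\<And>k. k \<in> S \<Longrightarrow> pairing v0 (d k) = 1" using exists_dual_vector by blast
  \<comment> \<open>The factor cancels \<open>\<i> * \<tau>\<close> in the exponent up to sign,
    leaving a real decay rate.\<close>
  define w0 where "w0 = (\<i> / \<tau>) *s v0"
  \<comment> \<open>Moving \<open>m\<close> along \<open>w0\<close> scales every generator term by \<open>exp (- 2 \<pi> t)\<close>, so the line
     through \<open>m\<close> eventually enters the region of convergence.\<close>
  have line: "?x (m + t *s w0) k = ?x m k * exp (- (2 * of_real pi * t))" if "k \<in> S" for t k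
  proof -
    have "pairing (m + t *s w0) (d k) = pairing m (d k) + t * (\<i> / \<tau>)"
      by (simp add: pairing_add pairing_scale w0_def v0[OF that])
    then have "2 * of_real pi * \<i> * \<tau> * pairing (m + t *s w0) (d k)
        = 2 * of_real pi * \<i> * \<tau> * pairing m (d k) + - (2 * of_real pi * t)"
      using \<open>\<tau> \<noteq> 0\<close> by (simp add: distrib_left)
    then show ?thesis
      unfolding cone_series_term_def by (simp only: exp_add mult_ac)
  qed
  have "\<forall>\<^sub>F t in at_top. norm (?x m k) * exp (- (2 * pi * t)) < 1" for k
  proof -
    have "((\<lambda>t. norm (?x m k) * exp (- (2 * pi * t))) \<longlongrightarrow> norm (?x m k) * 0) at_top"
      by (intro tendsto_mult tendsto_const filterlim_compose[OF exp_at_bot] 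
           filterlim_compose[OF filterlim_uminus_at_bot_at_top]
           filterlim_tendsto_pos_mult_at_top[OF tendsto_const _ filterlim_ident]) simp
    then show ?thesis by (rule order_tendstoD) simp
  qed
  then have "\<forall>\<^sub>F t in at_top. \<forall>k\<in>S. norm (?x m k) * exp (- (2 * pi * t)) < 1"
    using finite by (simp add: eventually_ball_finite)
  then obtain t0 where t0: "\<And>t k. t \<ge> t0 \<Longrightarrow> k \<in> S \<Longrightarrow> norm (?x m k) * exp (- (2 * pi * t)) < 1"
    by (auto simp: eventually_at_top_linorder)
  \<comment> \<open>The identity holds on an open half-plane of parameters \<open>t\<close>, hence
    on the whole plane; \<open>t = 0\<close> is the point \<open>m\<close>.\<close>
  have "P (m + 0 *s w0) * Q0 (m + 0 *s w0) = Q (m + 0 *s w0)"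
  proof (rule analytic_continuation_open[of "{t. Re t > t0}" UNIV
        "\<lambda>t. P (m + t *s w0) * Q0 (m + t *s w0)" "\<lambda>t. Q (m + t *s w0)" 0])
    show "{t. Re t > t0} \<noteq> {}" by (auto intro!: exI[of _ "of_real (t0 + 1)"])
    fix t assume "t \<in> {t. Re t > t0}"
    then have conv: "\<And>k. k \<in> S \<Longrightarrow> norm (?x (m + t *s w0) k) < 1"
      using t0[of "Re t"] by (simp add: line norm_mult)
    show "P (m + t *s w0) * Q0 (m + t *s w0) = Q (m + t *s w0)"
    proof -
      have "cone_series_term deg \<tau> (m + t *s w0) summable_on lattice_points (cone_spanned d S)"
        using conv by (rule cone_series_geometric(1))
      then have "P (m + t *s w0) * Q0 (m + t *s w0)
          = Q (m + t *s w0) * (Q0 (m + t *s w0)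
            * infsum (cone_series_term deg \<tau> (m + t *s w0)) (lattice_points (cone_spanned d S)))"
        by (simp only: PQsum[symmetric] mult_ac)
      also have "\<dots> = Q (m + t *s w0)" by (subst sum[OF conv]) simp_all
      finally show ?thesis .
    qed
  qed (simp_all add: holomorphic_on_mult entire_holomorphic_line[OF PQ(1)] entire_holomorphic_line[OF PQ(2)]
      entire_holomorphic_line[OF Q0] open_halfspace_Re_gt convex_connected)
  then have "P m * Q0 m = Q m" by simp
  then have "v * Q0 m = 1" using PQ(3,4) by simp
  then show "v = (\<Prod>k\<in>S. 1 / (1 - ?x m k))"
    unfolding val using Q0m by (simp add: eq_divide_eq)
qed

end

end

section \<open>Alternating sums over the boundary of a simplex\<close>

text \<open>As the \<open>x k\<close> multiply to \<open>1\<close>, the product over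
  \<open>B\<close> of \<open>1 / (1 - x k)\<close> equals that of \<open>1 / (1 - x k) - 1\<close>.
  Expanding the latter over all subsets reproduces the former as the term of \<open>B\<close>, so
  the remaining terms cancel.\<close>

lemma alternating_sum_proper_faces:
  fixes x :: "'k \<Rightarrow> 'a :: field"
  assumes B: "finite B" "card B = Suc m" and x: "\<And>k. k \<in> B \<Longrightarrow> x k \<noteq> 1" "prod x B = 1"
  shows "(\<Sum>S\<in>Pow B - {B}. (-1) ^ (m - card S) * (\<Prod>k\<in>S. 1 / (1 - x k))) = 0"
proof -
  let ?f = "\<lambda>S. \<Prod>k\<in>S. 1 / (1 - x k)"
  have "?f B = (\<Prod>k\<in>B. x k / (1 - x k))"
    using x(2) by (simp add: prod_dividef)
  also have "\<dots> = (\<Prod>k\<in>B. 1 / (1 - x k) - 1)"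
  proof (rule prod.cong)
    fix k assume "k \<in> B"
    then have "1 - x k \<noteq> 0" using x(1) by simp
    then show "x k / (1 - x k) = 1 / (1 - x k) - 1" by (simp add: field_simps)
  qed simp
  also have "\<dots> = (\<Sum>S\<in>Pow B. (-1) ^ (card B - card S) * ?f S)"
    by (subst prod_diff_conv_sum'[OF B(1)]) simp
  also have "\<dots> = ?f B + (\<Sum>S\<in>Pow B - {B}. (-1) ^ (card B - card S) * ?f S)"
    using B(1) by (subst sum.remove[of _ B]) auto
  also have "(\<Sum>S\<in>Pow B - {B}. (-1) ^ (card B - card S) * ?f S)
      = (\<Sum>S\<in>Pow B - {B}. - ((-1) ^ (m - card S) * ?f S))"
  proof (rule sum.cong)
    \<comment> \<open>Properness of \<open>S\<close> keeps the truncated subtraction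
      \<open>m - card S\<close> exact, so passing from \<open>card B\<close> to \<open>m\<close>
      costs one sign.\<close>
    fix S assume "S \<in> Pow B - {B}"
    then have "card S < card B" using B(1) by (intro psubset_card_mono) auto
    then have "card B - card S = Suc (m - card S)" using B(2) by simp
    then show "(-1) ^ (card B - card S) * ?f S = - ((-1) ^ (m - card S) * ?f S)" by simp
  qed simp
  finally show ?thesis by (simp add: sum_negf)
qed

subsection \<open>The fan of the projective bundle\<close>

locale projective_bundle =
  fixes n1 :: nat and i :: "nat \<Rightarrow> int" and b :: "nat \<Rightarrow> 'r::finite"
  assumes n1: "n1 \<ge> 1" and bij_b: "bij_betw b {1..n1 + 3} (UNIV :: 'r set)"
begin

abbreviation "d \<equiv> ray n1 i b"
abbreviation "base_rays \<equiv> {1..n1 + 1}"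
abbreviation "fibre_rays \<equiv> {n1 + 2..n1 + 5}"

definition faces :: "nat set set" where
  "faces = {S. S \<subseteq> {1..n1 + 5} \<and> \<not> base_rays \<subseteq> S \<and> \<not> fibre_rays \<subseteq> S}"

lemma b_eq_iff: "s \<in> {1..n1 + 3} \<Longrightarrow> t \<in> {1..n1 + 3} \<Longrightarrow> b s = b t \<longleftrightarrow> s = t"
  using bij_b by (auto simp: bij_betw_def inj_on_def)

lemma coordinateE: obtains t where "j = b t" "t \<in> {1..n1 + 3}"
  using bij_b by (metis UNIV_I bij_betw_def imageE)

text \<open>Coordinate \<open>n1 + j\<close> belongs to ray \<open>n1 + 2 + j\<close>, since two
  further rays are numbered in between; hence the shift \<open>t + 2\<close>.\<close>

lemma ray_nth:
  assumes t: "t \<in> {1..n1 + 3}" and k: "k \<in> {1..n1 + 5}"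
  shows "d k $ b t =
    (if k \<le> n1 then of_bool (k = t)
     else if k = n1 + 1 then (if t \<le> n1 then -1 else i (t - n1))
     else if k = n1 + 2 then (if t \<le> n1 then 0 else -1)
     else of_bool (k = t + 2))"
proof -
  have ax: "axis (b s) 1 $ b t = (of_bool (s = t) :: int)" if "s \<in> {1..n1 + 3}" for s
    using b_eq_iff[OF that t] by (auto simp: axis_def)
  have "(\<Sum>s = 1..n1. axis (b s) 1 $ b t) = (\<Sum>s = 1..n1. of_bool (s = t) :: int)"
    by (rule sum.cong) (use ax in auto)
  also have "\<dots> = of_bool (t \<le> n1)"
    using t by (simp add: of_bool_def sum.delta)
  finally have sum_e: "(\<Sum>s = 1..n1. axis (b s) 1 $ b t) = (of_bool (t \<le> n1) :: int)" .
  have 3: "{1..3} = {1, 2, 3 :: nat}" by auto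
  have sum_g: "(\<Sum>j = 1..3. f j * axis (b (n1 + j)) 1 $ b t) = (if t \<le> n1 then 0 else f (t - n1))"
    for f :: "nat \<Rightarrow> int"
  proof -
    have "t = n1 + 1 \<or> t = n1 + 2 \<or> t = n1 + 3 \<or> t \<le> n1" using t by auto
    then show ?thesis unfolding 3 by (auto simp: ax)
  qed
  consider "k \<le> n1" | "k = n1 + 1" | "k = n1 + 2" | "k > n1 + 2" by linarith
  then show ?thesis
  proof cases
    case 1
    then show ?thesis using k by (simp add: ray_def ax)
  next
    case 2
    then show ?thesis by (simp add: ray_def sum_e sum_g del: One_nat_def)
  next
    case 3
    then show ?thesis using sum_g[of "\<lambda>_. 1"] by (simp add: ray_def del: One_nat_def)
  next
    case 4
    define s where "s = n1 + (k - (n1 + 2))"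
    have "s \<in> {1..n1 + 3}" "s = t \<longleftrightarrow> k = t + 2" using 4 k by (auto simp: s_def)
    moreover have "d k $ b t = axis (b s) 1 $ b t" using 4 by (simp add: ray_def s_def)
    ultimately show ?thesis using 4 ax by simp
  qed
qed

text \<open>A general coefficient ring serves both real relations and integral expansions.\<close>

lemma ray_combination_nth:
  fixes c :: "nat \<Rightarrow> 'a :: comm_ring_1"
  assumes t: "t \<in> {1..n1 + 3}"
  shows "(\<Sum>k = 1..n1 + 5. c k * of_int (d k $ b t)) =
    (if t \<le> n1 then c t - c (n1 + 1) else of_int (i (t - n1)) * c (n1 + 1) - c (n1 + 2) + c (t + 2))"
proof -
  have split: "{1..n1 + 5} = {1..n1} \<union> {n1 + 1, n1 + 2, n1 + 3, n1 + 4, n1 + 5}" by auto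
  have "(\<Sum>k = 1..n1. c k * of_int (d k $ b t)) = (\<Sum>k = 1..n1. if k = t then c k else 0)"
    by (rule sum.cong) (use t in \<open>auto simp: ray_nth\<close>)
  also have "\<dots> = (if t \<le> n1 then c t else 0)"
    using t by (simp add: sum.delta')
  finally have base: "(\<Sum>k = 1..n1. c k * of_int (d k $ b t)) = (if t \<le> n1 then c t else 0)" .
  have "t = n1 + 1 \<or> t = n1 + 2 \<or> t = n1 + 3 \<or> t \<le> n1" using t by auto
  then show ?thesis
    unfolding split
    by (subst sum.union_disjoint, simp, simp, force, subst base)
       (auto simp: ray_nth[OF t] numeral_eq_Suc)
qed

section \<open>Linear relations among the rays\<close>

text \<open>Each coordinate gives one equation. With \<open>u = c (n1 + 1)\<close> and
  \<open>v = c (n1 + 2)\<close> the coefficients are \<open>u\<close> on the base rays and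
  \<open>v - i j * u\<close> on the last three, matching the classes of the toric divisors.\<close>

lemma relation_coeffs:
  assumes "(\<Sum>k = 1..n1 + 5. c k *\<^sub>R real_vec (d k)) = 0"
  shows "s \<in> base_rays \<Longrightarrow> c s = c (n1 + 1)"
    and "j \<in> {1..3} \<Longrightarrow> c (n1 + 2 + j) = c (n1 + 2) - of_int (i j) * c (n1 + 1)"
proof -
  have eq: "(\<Sum>k = 1..n1 + 5. c k * of_int (d k $ b t)) = 0" for t
    using arg_cong[OF assms, of "\<lambda>v. v $ b t"] by (simp add: real_vec_def)
  show "c s = c (n1 + 1)" if "s \<in> base_rays"
    using that ray_combination_nth[of s c] eq[of s] by (cases "s = n1 + 1") auto
  show "c (n1 + 2 + j) = c (n1 + 2) - of_int (i j) * c (n1 + 1)" if "j \<in> {1..3}"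
    using that ray_combination_nth[of "n1 + j" c] eq[of "n1 + j"] 
    by (auto simp: algebra_simps)
qed

lemma relation_fibre_coeffs:
  assumes rel: "(\<Sum>k = 1..n1 + 5. c k *\<^sub>R real_vec (d k)) = 0"
    and p: "p \<in> base_rays" "c p = 0" and k: "k \<in> fibre_rays"
  shows "c k = c (n1 + 2)"
proof (cases "k = n1 + 2")
  case False
  with k obtain j where j: "k = n1 + 2 + j" "j \<in> {1..3}"
    by (intro that[of "k - (n1 + 2)"]) auto
  have "c (n1 + 1) = 0" using relation_coeffs(1)[OF rel p(1)] p(2) by simp
  then show ?thesis using relation_coeffs(2)[OF rel j(2)] j(1) by simp
qed simp

text \<open>Relations form a two-parameter family; a zero among the base rays and one among the
  fibre rays kill both parameters.\<close>

lemma relation_trivial: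
  assumes rel: "(\<Sum>k = 1..n1 + 5. c k *\<^sub>R real_vec (d k)) = 0"
    and p: "p \<in> base_rays" "c p = 0" and q: "q \<in> fibre_rays" "c q = 0"
    and k: "k \<in> {1..n1 + 5}"
  shows "c k = 0"
proof (cases "k \<in> base_rays")
  case True
  then show ?thesis using relation_coeffs(1)[OF rel] p by metis
next
  case False
  with k have "k \<in> fibre_rays" by auto
  then show ?thesis using relation_fibre_coeffs[OF rel p] q by metis
qed

text \<open>The relations among the rays are generated by one relation whose base coefficients are all
  \<open>1\<close> and one whose fibre coefficients are all \<open>1\<close> and base coefficients \<open>0\<close>; subtracting
  multiples of these clears the coefficients at \<open>p\<close> and \<open>q\<close>.\<close>

lemma integral_combination:
  assumes "p \<in> base_rays" "q \<in> fibre_rays"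
  shows "\<exists>z. n = (\<Sum>k = 1..n1 + 5. z k *s d k) \<and> z p = 0 \<and> z q = 0"
proof -
  \<comment> \<open>\<open>z0\<close> holds the coordinates of \<open>n\<close> in the standard
    basis, with zeros at rays \<open>n1 + 1\<close> and \<open>n1 + 2\<close>; \<open>r\<close> is
    the relation with \<open>u = 1\<close> and \<open>v = 0\<close>.\<close>
  define z0 where "z0 k = (if k \<le> n1 then n $ b k else if k \<le> n1 + 2 then 0 else n $ b (k - 2))" for k
  define r where "r k = (if k \<le> n1 + 1 then 1 else if k = n1 + 2 then 0 else - i (k - (n1 + 2)))" for k
  define z1 where "z1 k = z0 k - z0 p * r k" for k
  define z where "z k = z1 k - z1 q * of_bool (n1 + 1 < k)" for k
  have "n $ j = (\<Sum>k = 1..n1 + 5. z k *s d k) $ j" for j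
  proof -
    obtain t where t: "j = b t" "t \<in> {1..n1 + 3}" by (rule coordinateE)
    then show ?thesis
      using ray_combination_nth[OF t(2), of z]
      by (auto simp: z_def z1_def z0_def r_def algebra_simps)
  qed
  moreover have "z p = 0" "z q = 0"
    using assms by (auto simp: z_def z1_def r_def)
  ultimately show ?thesis by (auto simp: vec_eq_iff)
qed

lemma sum_extend_zero:
  assumes "S \<subseteq> {1..n1 + 5}"
  shows "(\<Sum>k = 1..n1 + 5. (if k \<in> S then c k else 0) *\<^sub>R real_vec (d k)) = (\<Sum>k\<in>S. c k *\<^sub>R real_vec (d k))"
  by (rule sum.mono_neutral_cong_right) (use assms in auto)

text \<open>A face misses a base ray \<open>p\<close> and a fibre ray \<open>q\<close>, so
  \<open>relation_trivial\<close> gives independence. It also forces the real expansion of a lattice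
  point to agree with the integral one that vanishes at \<open>p\<close> and
  \<open>q\<close>.\<close>

lemma unimodular_face:
  assumes "S \<in> faces"
  shows "unimodular_cone d S"
proof
  obtain p q where S: "S \<subseteq> {1..n1 + 5}" and p: "p \<in> base_rays" "p \<notin> S" and q: "q \<in> fibre_rays" "q \<notin> S"
    using assms unfolding faces_def by blast
  show "finite S" using S finite_subset by blast
  show "c k = 0" if rel: "(\<Sum>k\<in>S. c k *\<^sub>R real_vec (d k)) = 0" and k: "k \<in> S" for c k
  proof -
    have "(\<Sum>k = 1..n1 + 5. (if k \<in> S then c k else 0) *\<^sub>R real_vec (d k)) = 0"
      using rel by (simp only: sum_extend_zero[OF S])
    from relation_trivial[OF this p(1) _ q(1), of k] p(2) q(2) k S show ?thesis by auto
  qed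
  fix n assume "n \<in> lattice_points (cone_spanned d S)"
  then obtain t where t: "real_vec n = (\<Sum>k\<in>S. t k *\<^sub>R real_vec (d k))" "\<And>k. k \<in> S \<Longrightarrow> 0 \<le> t k"
    unfolding lattice_points_def cone_spanned_def by blast
  obtain z where z: "n = (\<Sum>k = 1..n1 + 5. z k *s d k)" "z p = 0" "z q = 0"
    using integral_combination[OF p(1) q(1)] by blast
  have "(\<Sum>k = 1..n1 + 5. ((if k \<in> S then t k else 0) - of_int (z k)) *\<^sub>R real_vec (d k)) = 0"
    using arg_cong[OF z(1), of real_vec]
    by (simp only: scaleR_diff_left sum_subtractf sum_extend_zero[OF S] real_vec_sum real_vec_scale t(1)) simp
  from relation_trivial[OF this p(1) _ q(1)] p q z
  have eq: "(if k \<in> S then t k else 0) = of_int (z k)" if "k \<in> {1..n1 + 5}" for k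
    using that by force
  have "n = (\<Sum>k\<in>S. z k *s d k)"
    unfolding z(1)
  proof (rule sum.mono_neutral_right)
    show "\<forall>k\<in>{1..n1 + 5} - S. z k *s d k = 0"
      using eq by force
  qed (use S in auto)
  also have "\<dots> = (\<Sum>k\<in>S. of_nat (nat (z k)) *s d k)"
  proof (rule sum.cong)
    fix k assume k: "k \<in> S"
    then have "0 \<le> z k" using eq[of k] t(2)[OF k] S by auto
    then show "z k *s d k = of_nat (nat (z k)) *s d k" by simp
  qed simp
  finally show "\<exists>a. n = (\<Sum>k\<in>S. of_nat (a k) *s d k)" by (rule exI[of _ "\<lambda>k. nat (z k)"])
qed

text \<open>Otherwise the ray minus its expansion is a relation \<open>c\<close> whose only positive
  coefficient is at \<open>k\<close>. But its coefficients are constant on the block of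
  \<open>k\<close>, which contains another ray.\<close>

lemma ray_mem_face_cone:
  assumes S: "S \<in> faces" and k: "k \<in> {1..n1 + 5}" and mem: "real_vec (d k) \<in> cone_spanned d S"
  shows "k \<in> S"
proof (rule ccontr)
  assume notin: "k \<notin> S"
  obtain t where t: "real_vec (d k) = (\<Sum>k\<in>S. t k *\<^sub>R real_vec (d k))" "\<And>j. j \<in> S \<Longrightarrow> 0 \<le> t j"
    using mem unfolding cone_spanned_def by blast
  define c where "c j = (if j = k then 1 else 0) - (if j \<in> S then t j else 0)" for j
  have "(\<Sum>j = 1..n1 + 5. (if j = k then 1 else 0) *\<^sub>R real_vec (d j)) = real_vec (d k)"
    using k by (simp add: if_distrib[of "\<lambda>c. c *\<^sub>R _"] sum.delta cong: if_cong)
  moreover have "S \<subseteq> {1..n1 + 5}" using S by (simp add: faces_def)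
  ultimately have rel: "(\<Sum>j = 1..n1 + 5. c j *\<^sub>R real_vec (d j)) = 0"
    by (simp only: c_def scaleR_diff_left sum_subtractf sum_extend_zero t(1)) simp
  have ck: "c k = 1" using notin by (simp add: c_def)
  have neg: "c j \<le> 0" if "j \<noteq> k" for j using that t(2) by (simp add: c_def)
  obtain p where p: "p \<in> base_rays" "p \<notin> S" using S unfolding faces_def by blast
  show False
  proof (cases "k \<in> base_rays")
    case True
    have "c j = 1" if "j \<in> base_rays" for j
      using relation_coeffs(1)[OF rel] that True ck by metis
    \<comment> \<open>As \<open>n1\<close> is positive, rays \<open>1\<close> and
      \<open>n1 + 1\<close> differ, so one of them is not \<open>k\<close>.\<close>
    from this[of 1] this[of "n1 + 1"] neg[of 1] neg[of "n1 + 1"] n1 show False by fastforce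
  next
    case False
    then have "c p = 0" using p by (auto simp: c_def)
    then have "c j = c (n1 + 2)" if "j \<in> fibre_rays" for j
      using relation_fibre_coeffs[OF rel p(1)] that by blast
    from this[of k] this[of "n1 + 3"] neg[of "n1 + 2"] neg[of "n1 + 3"] ck False k show False by fastforce
  qed
qed

text \<open>The fan is a set of cones, so summing over \<open>faces\<close> instead requires that no
  cone is counted twice.\<close>

lemma inj_on_cone_spanned: "inj_on (cone_spanned d) faces"
proof (rule inj_onI)
  have sub: "S \<subseteq> T" if "S \<in> faces" "T \<in> faces" "cone_spanned d S = cone_spanned d T" for S T
  proof
    fix k assume k: "k \<in> S"
    then have "real_vec (d k) \<in> cone_spanned d T"
      using unimodular_cone.generator_mem[OF unimodular_face[OF that(1)]] that(3) by simp
    then show "k \<in> T" using ray_mem_face_cone[OF that(2)] k that(1) by (auto simp: faces_def)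
  qed
  fix S T assume "S \<in> faces" "T \<in> faces" "cone_spanned d S = cone_spanned d T"
  then show "S = T" using sub by (metis subset_antisym)
qed

text \<open>This is the relation with \<open>u = 0\<close> and \<open>v = 1\<close>.\<close>

lemma sum_fibre_rays: "(\<Sum>k\<in>fibre_rays. d k) = 0"
proof -
  have "(\<Sum>k\<in>fibre_rays. d k) $ j = 0" for j
  proof -
    obtain t where t: "j = b t" "t \<in> {1..n1 + 3}" by (rule coordinateE)
    define c :: "nat \<Rightarrow> int" where "c k = (if k \<in> fibre_rays then 1 else 0)" for k
    have "(\<Sum>k = 1..n1 + 5. c k * of_int (d k $ b t)) = (\<Sum>k\<in>fibre_rays. d k $ b t)"
      by (rule sum.mono_neutral_cong_right) (auto simp: c_def)
    then have "(\<Sum>k\<in>fibre_rays. d k $ b t) = 0"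
      unfolding ray_combination_nth[OF t(2)] using t(2) by (auto simp: c_def split: if_splits)
    then show ?thesis using t(1) by simp
  qed
  then show ?thesis by (simp add: vec_eq_iff)
qed

text \<open>The boundary complex is the join of the boundaries of two simplices.\<close>

lemma sum_faces:
  fixes f g :: "nat set \<Rightarrow> 'a :: comm_ring_1"
  assumes "\<And>S T. S \<subseteq> base_rays \<Longrightarrow> T \<subseteq> fibre_rays \<Longrightarrow> S \<noteq> base_rays \<Longrightarrow> T \<noteq> fibre_rays
      \<Longrightarrow> h (S \<union> T) = f S * g T"
  shows "sum h faces = sum f (Pow base_rays - {base_rays}) * sum g (Pow fibre_rays - {fibre_rays})"
proof -
  have "sum h faces = (\<Sum>(S, T)\<in>(Pow base_rays - {base_rays}) \<times> (Pow fibre_rays - {fibre_rays}). f S * g T)"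
  proof (rule sum.reindex_bij_witness[where i = "\<lambda>(S, T). S \<union> T" and j = "\<lambda>S. (S \<inter> base_rays, S \<inter> fibre_rays)"])
    fix S assume S: "S \<in> faces"
    then have eq: "S = (S \<inter> base_rays) \<union> (S \<inter> fibre_rays)" by (force simp: faces_def)
    then show "(case (S \<inter> base_rays, S \<inter> fibre_rays) of (S, T) \<Rightarrow> S \<union> T) = S" by simp
    show mem: "(S \<inter> base_rays, S \<inter> fibre_rays) \<in> (Pow base_rays - {base_rays}) \<times> (Pow fibre_rays - {fibre_rays})"
      using S unfolding faces_def by blast
    show "(case (S \<inter> base_rays, S \<inter> fibre_rays) of (S, T) \<Rightarrow> f S * g T) = h S"
      using assms[of "S \<inter> base_rays" "S \<inter> fibre_rays"] mem eq by auto
  next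
    have disj: "base_rays \<inter> fibre_rays = {}" and un: "base_rays \<subseteq> {1..n1 + 5}" "fibre_rays \<subseteq> {1..n1 + 5}"
      by auto
    fix ST assume "ST \<in> (Pow base_rays - {base_rays}) \<times> (Pow fibre_rays - {fibre_rays})"
    then obtain S T where ST: "ST = (S, T)" "S \<subseteq> base_rays" "S \<noteq> base_rays" "T \<subseteq> fibre_rays" "T \<noteq> fibre_rays"
      by auto
    have int: "(S \<union> T) \<inter> base_rays = S" "(S \<union> T) \<inter> fibre_rays = T" using ST disj by blast+
    then show "((case ST of (S, T) \<Rightarrow> S \<union> T) \<inter> base_rays, (case ST of (S, T) \<Rightarrow> S \<union> T) \<inter> fibre_rays) = ST"
      using ST by simp
    have "\<not> base_rays \<subseteq> S \<union> T" "\<not> fibre_rays \<subseteq> S \<union> T" using int ST(3,5) by blast+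
    then show "(case ST of (S, T) \<Rightarrow> S \<union> T) \<in> faces"
      using ST un unfolding faces_def by auto
  qed
  then show ?thesis by (simp only: sum_product sum.cartesian_product)
qed

section \<open>Vanishing of the toric form\<close>

lemma toric_summand_eq_0:
  assumes "\<tau> \<noteq> 0" and deg: "degree_function (bundle_fan n1 i b) deg"
    and x: "\<And>k. k \<in> {1..n1 + 5} \<Longrightarrow> cone_series_term deg \<tau> (complex_vec m) (d k) \<noteq> 1"
    and int: "(\<Sum>k\<in>fibre_rays. deg (d k)) \<in> \<int>"
  shows "toric_summand (bundle_fan n1 i b) deg \<tau> m = 0"
proof -
  define x where "x k = cone_series_term deg \<tau> (complex_vec m) (d k)" for k
  have card_r: "CARD('r) = n1 + 3"
    using bij_betw_same_card[OF bij_b] by simp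
  have fan: "bundle_fan n1 i b = cone_spanned d ` faces"
    by (auto simp: bundle_fan_def faces_def)
  have ac: "cone_ac deg \<tau> (cone_spanned d S) (complex_vec m) = (\<Prod>k\<in>S. 1 / (1 - x k))" if S: "S \<in> faces" for S
  proof -
    interpret unimodular_cone d S using S by (rule unimodular_face)
    obtain l :: "real ^ 'r \<Rightarrow> complex" where l: "linear l" "\<And>n. n \<in> lattice_points (cone_spanned d S) \<Longrightarrow> deg n = l (real_vec n)"
      using deg S unfolding degree_function_def fan by blast
    show ?thesis
      unfolding x_def using S x by (intro cone_ac_eq[OF l \<open>\<tau> \<noteq> 0\<close>]) (auto simp: faces_def)
  qed
  have "(\<Sum>k\<in>fibre_rays. pairing (complex_vec m) (d k)) = pairing (complex_vec m) (\<Sum>k\<in>fibre_rays. d k)"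
    using pairing_sum_right[of "complex_vec m" "\<lambda>_. 1" d fibre_rays] by simp
  also have "\<dots> = 0"
    unfolding sum_fibre_rays by (simp add: pairing_def)
  finally have "(\<Sum>k\<in>fibre_rays. pairing (complex_vec m) (d k)) = 0" .
  moreover have "exp (2 * of_real pi * \<i> * (\<Sum>k\<in>fibre_rays. deg (d k))) = 1"
    using int by (elim Ints_cases) (auto simp: exp_eq_1)
  ultimately have prod_x: "prod x fibre_rays = 1"
    by (simp add: x_def cone_series_term_def prod.distrib flip: exp_sum sum_distrib_left)
  have "toric_summand (bundle_fan n1 i b) deg \<tau> m
      = (\<Sum>S\<in>faces. (-1) ^ (n1 + 3 - card S) * (\<Prod>k\<in>S. 1 / (1 - x k)))"
    unfolding toric_summand_def fan sum.reindex[OF inj_on_cone_spanned]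
    by (intro sum.cong) (simp_all add: ac unimodular_cone.dim_cone[OF unimodular_face] card_r)
  also have "\<dots> = (\<Sum>S\<in>Pow base_rays - {base_rays}. (-1) ^ (n1 - card S) * (\<Prod>k\<in>S. 1 / (1 - x k)))
      * (\<Sum>S\<in>Pow fibre_rays - {fibre_rays}. (-1) ^ (3 - card S) * (\<Prod>k\<in>S. 1 / (1 - x k)))"
  proof (rule sum_faces)
    fix S T assume ST: "S \<subseteq> base_rays" "T \<subseteq> fibre_rays" "S \<noteq> base_rays" "T \<noteq> fibre_rays"
    then have fin: "finite S" "finite T" by (auto intro: finite_subset)
    have "base_rays \<inter> fibre_rays = {}" by auto
    then have disj: "S \<inter> T = {}" using ST by blast
    have "S \<subset> base_rays" "T \<subset> fibre_rays" using ST by blast+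
    \<comment> \<open>Proper subsets have at most \<open>n1\<close> and \<open>3\<close> elements,
      so the truncated codimension splits exactly.\<close>
    from this[THEN psubset_card_mono[OF finite_atLeastAtMost]]
    have "n1 + 3 - (card S + card T) = (n1 - card S) + (3 - card T)" by simp
    then show "(-1) ^ (n1 + 3 - card (S \<union> T)) * (\<Prod>k\<in>S \<union> T. 1 / (1 - x k))
      = (-1) ^ (n1 - card S) * (\<Prod>k\<in>S. 1 / (1 - x k)) * ((-1) ^ (3 - card T) * (\<Prod>k\<in>T. 1 / (1 - x k)))"
      by (simp only: card_Un_disjoint[OF fin disj] prod.union_disjoint[OF fin disj] power_add mult_ac)
  qed
  also have "(\<Sum>S\<in>Pow fibre_rays - {fibre_rays}. (-1) ^ (3 - card S) * (\<Prod>k\<in>S. 1 / (1 - x k))) = 0"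
    using x prod_x by (intro alternating_sum_proper_faces) (auto simp: x_def)
  finally show ?thesis by (simp only: mult_zero_right)
qed

end

text \<open>The value \<open>1\<close> would make \<open>\<tau> * N + deg n\<close> an integer for
  the integer pairing \<open>N\<close>. If \<open>N = 0\<close> this contradicts the nonintegral
  degree; otherwise \<open>Im \<tau> * N\<close> is too large to be cancelled by
  \<open>Im (deg n)\<close>.\<close>

lemma cone_series_term_neq_1:
  assumes "deg n \<notin> \<int>" "\<bar>Im (deg n)\<bar> < Im \<tau>"
  shows "cone_series_term deg \<tau> (complex_vec m) n \<noteq> 1"
proof
  define N where "N = (\<Sum>k\<in>UNIV. m $ k * n $ k)"
  have N: "pairing (complex_vec m) n = of_int N"
    by (simp add: pairing_def complex_vec_def N_def)
  assume "cone_series_term deg \<tau> (complex_vec m) n = 1"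
  then have "exp (2 * of_real pi * \<i> * (\<tau> * of_int N + deg n)) = 1"
    by (simp only: cone_series_term_def N mult_exp_exp distrib_left mult.assoc)
  then obtain z :: int where z: "Im \<tau> * of_int N + Im (deg n) = 0"
      "2 * pi * (Re \<tau> * of_int N + Re (deg n)) = of_int (2 * z) * pi"
    unfolding exp_eq_1 by (auto simp: mult.assoc)
  show False
  proof (cases "N = 0")
    case True
    with z have "deg n = of_int z" by (simp add: complex_eq_iff)
    with assms(1) show False by simp
  next
    case False
    then have "1 \<le> \<bar>real_of_int N\<bar>" by linarith
    then have "Im \<tau> \<le> \<bar>Im \<tau> * of_int N\<bar>"
      using assms(2) mult_left_mono[of 1 "\<bar>real_of_int N\<bar>" "Im \<tau>"] by (simp add: abs_mult)
    with z(1) assms(2) show False by linarith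
  qed
qed

theorem theorem1p3:
  fixes n1 :: nat
    and i :: "nat \<Rightarrow> int"
    and b :: "nat \<Rightarrow> 'r::finite"
    and \<alpha> :: "nat \<Rightarrow> complex"
    and deg :: "int ^ 'r \<Rightarrow> complex"
  assumes "n1 \<ge> 1"
    and "bij_betw b {1..n1 + 3} (UNIV :: 'r set)"
    and "degree_function (bundle_fan n1 i b) deg"
    and "\<And>k. k \<in> {1..n1 + 5} \<Longrightarrow> deg (ray n1 i b k) = \<alpha> k"
    and "\<And>k. k \<in> {1..n1 + 5} \<Longrightarrow> \<alpha> k \<notin> \<int>"
    and "pairwise_coprime3 (i 1) (i 2) (i 3)"
    and "pairwise_coprime3 (i 1) (i 1 - i 2) (i 1 - i 3)"
    and "pairwise_coprime3 (i 2) (i 2 - i 1) (i 2 - i 3)"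
    and "pairwise_coprime3 (i 3) (i 3 - i 1) (i 3 - i 2)"
    and "(\<Sum>j = 0..3. \<alpha> (n1 + 2 + j)) \<in> \<int>"
    and "(\<Sum>s = 1..n1 + 1. \<alpha> s) - (\<Sum>j = 1..3. of_int (i j) * \<alpha> (n1 + 2 + j)) \<in> \<int>"
  shows "\<exists>\<epsilon>>0. \<forall>\<tau>. 0 < Im \<tau> \<and> cmod (exp (2 * of_real pi * \<i> * \<tau>)) < \<epsilon> \<longrightarrow>
           (\<lambda>m. norm (toric_summand (bundle_fan n1 i b) deg \<tau> m)) summable_on UNIV \<and>
           toric_form (bundle_fan n1 i b) deg \<tau> = 0"
proof -
  interpret projective_bundle n1 i b using assms(1,2) by unfold_locales
  \<comment> \<open>\<open>K\<close> bounds every \<open>\<bar>Im (\<alpha> k)\<bar>\<close>, and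
    the modulus of \<open>q\<close> is below \<open>exp (- (2 * pi * K))\<close> exactly when
    \<open>Im \<tau>\<close> exceeds \<open>K\<close>.\<close>
  define K where "K = (\<Sum>k = 1..n1 + 5. \<bar>Im (\<alpha> k)\<bar>)"
  have "(\<Sum>k\<in>fibre_rays. \<alpha> k) = (\<Sum>j = 0..3. \<alpha> (n1 + 2 + j))"
    using sum.shift_bounds_cl_nat_ivl[of \<alpha> 0 "n1 + 2" 3] by (simp add: ac_simps)
  moreover have "(\<Sum>k\<in>fibre_rays. deg (d k)) = (\<Sum>k\<in>fibre_rays. \<alpha> k)"
    by (rule sum.cong) (use assms(4) in auto)
  ultimately have int: "(\<Sum>k\<in>fibre_rays. deg (d k)) \<in> \<int>" using assms(10) by simp
  have zero: "toric_summand (bundle_fan n1 i b) deg \<tau> m = 0"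
    if "0 < Im \<tau>" "cmod (exp (2 * of_real pi * \<i> * \<tau>)) < exp (- (2 * pi * K))" for \<tau> m
  proof (rule toric_summand_eq_0[OF _ assms(3) _ int])
    show "\<tau> \<noteq> 0" using that by auto
    have "K < Im \<tau>" using that(2) by simp
    fix k assume k: "k \<in> {1..n1 + 5}"
    have "\<bar>Im (\<alpha> k)\<bar> \<le> K" unfolding K_def by (rule member_le_sum[OF k]) auto
    then show "cone_series_term deg \<tau> (complex_vec m) (d k) \<noteq> 1"
      using \<open>K < Im \<tau>\<close> assms(4,5)[OF k] by (intro cone_series_term_neq_1) auto
  qed
  \<comment> \<open>Every summand is zero, which gives absolute convergence and the value of the
    form together.\<close>
  show ?thesis
    by (intro exI[of _ "exp (- (2 * pi * K))"]) (auto simp: toric_form_def zero)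
qed

end
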